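(* Let $m\ge 2$ be an integer and let $P$ be a polynomial in $\Pi_{m,2}$. Then $D_{m-1}\subset S_P$ if and only if $$P(z)=\frac{m-1}{m}\left(1+\frac{z}{m-1}\right)^m+\frac1m .$$
   Context: For integers $0\le n\le m$, $\Pi_{m,n}$ is the class of polynomials $P(z)=\sum_{k=0}^m \alpha_k \frac{z^k}{k!}$ with $\alpha_0=\dots=\alpha_n=1$ (the coefficients $\alpha_k$, $k>n$, being arbitrary complex numbers). The stability region of $P$ is $S_P=\{z\in\mathbb{C} : |P(z)|\le 1\}$, and $D_r=\{z\in\mathbb{C} : |z+r|\le r\}$. *)

theory Defs
  imports "HOL-Analysis.Analysis" "HOL-Computational_Algebra.Polynomial"
begin

(* Only meant for n \<le> m. *)
definition Pi_class :: "nat \<Rightarrow> nat \<Rightarrow> complex poly set" where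
  "Pi_class m n =
     {P. \<exists>\<alpha> :: nat \<Rightarrow> complex. (\<forall>k\<le>n. \<alpha> k = 1) \<and> P = (\<Sum>k\<le>m. monom (\<alpha> k / fact k) k)}"

definition stability_region :: "complex poly \<Rightarrow> complex set" where
  "stability_region P = {z. cmod (poly P z) \<le> 1}"

definition disk :: "real \<Rightarrow> complex set" where
  "disk r = {z. cmod (z + complex_of_real r) \<le> r}"

end

theory Submission
  imports Defs
begin

text \<open>
  The change of variable \<open>w = 1 + z / (m - 1)\<close> maps the disk onto the closed unit disk and turns
  \<open>P\<close> into a polynomial \<open>Q\<close> of degree at most \<open>m\<close> with \<open>Q 1 = 1\<close>, \<open>Q' 1 = m - 1\<close> and
  \<open>Q'' 1 = (m - 1)\<^sup>2\<close>. The claim becomes: if \<open>\<bar>Q\<bar> \<le> 1\<close> on the unit disk, then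
  \<open>Q w = (m - 1) / m * w ^ m + 1 / m\<close>.

  The extremal polynomial equals \<open>1\<close> at every \<open>m\<close>-th root of unity, which suggests sampling \<open>Q\<close>
  there. These samples determine \<open>Q\<close> up to a multiple of \<open>w ^ m - 1\<close>, and the functional
  \<open>Q \<mapsto> (m - 1) * Q' 1 - Q'' 1\<close> annihilates \<open>w ^ m - 1\<close>; hence it can be written in terms of the
  samples. The resulting formula, \<open>roots_unity_quadrature\<close>, reads
  \<open>(\<Sum>w. 2 / \<bar>1 - w\<bar>\<^sup>2 * (Q 1 - Q w)) = (m - 1) * Q' 1 - Q'' 1\<close>, where \<open>w\<close> runs over the \<open>m\<close>-th
  roots of unity other than \<open>1\<close>. What matters is that all its weights are positive. The prescribed
  derivatives make the right-hand side vanish, whereas \<open>\<bar>Q w\<bar> \<le> 1 = Q 1\<close> makes the real part of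
  every term on the left nonnegative. So every term is zero and \<open>Q w = 1\<close> at each root of unity
  (\<open>eq_one_on_roots_unity\<close>). Therefore \<open>Q - 1\<close> is a multiple of \<open>w ^ m - 1\<close>, and the factor is
  read off from \<open>Q' 1\<close>. The converse is the triangle inequality.
\<close>

section \<open>A quadrature formula at the roots of unity\<close>

text \<open>
  Multiplication by a root \<open>u\<close> permutes the \<open>m\<close>-th roots of unity, so the sum is invariant under
  multiplication by \<open>u ^ j\<close>; for \<open>0 < j < m\<close> some \<open>u\<close> has \<open>u ^ j \<noteq> 1\<close>, because only \<open>j\<close>
  complex numbers satisfy \<open>u ^ j = 1\<close>.
\<close>

lemma sum_power_roots_unity_eq_0:
  assumes "0 < j" "j < m"
  shows "(\<Sum>w | w ^ m = 1. w ^ j) = (0 :: complex)"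
proof -
  let ?U = "{w :: complex. w ^ m = 1}"
  have "card {w :: complex. w ^ j = 1} < card ?U"
    using assms by (simp add: card_roots_unity_eq)
  moreover have "finite {w :: complex. w ^ j = 1}"
    using assms by (intro finite_roots_unity) auto
  ultimately obtain u :: complex where u: "u ^ m = 1" "u ^ j \<noteq> 1"
    using card_mono[of "{w. w ^ j = 1}" ?U] by (auto simp: not_less[symmetric])
  have "u \<noteq> 0"
    using u assms by (auto simp: power_0_left)
  have "bij_betw (\<lambda>w. u * w) ?U ?U"
    using u \<open>u \<noteq> 0\<close>
    by (intro bij_betwI[where g = "\<lambda>w. w / u"]) (auto simp: power_mult_distrib power_divide)
  then have "(\<Sum>w\<in>?U. w ^ j) = (\<Sum>w\<in>?U. (u * w) ^ j)"
    by (rule sum.reindex_bij_betw[symmetric])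
  also have "\<dots> = u ^ j * (\<Sum>w\<in>?U. w ^ j)"
    by (simp add: power_mult_distrib sum_distrib_left)
  finally show ?thesis
    using u by simp
qed

text \<open>
  This is the quadrature formula for \<open>w ^ j\<close>. As a function of \<open>j\<close>, the left-hand side has constant
  second difference \<open>-2\<close>: the second difference of \<open>w ^ j\<close> carries the factor
  \<open>w - 2 + 1 / w = - \<bar>1 - w\<bar>\<^sup>2\<close>, which cancels the weight and leaves a power sum over the nontrivial
  roots. A quadratic with this second difference that vanishes at \<open>j = 0\<close> and \<open>j = m\<close> is
  \<open>j * (m - j)\<close>.
\<close>

lemma roots_unity_quadrature_power:
  assumes "2 \<le> m" "j \<le> m"
  shows "(\<Sum>w\<in>{w. w ^ m = 1} - {1}. of_real (2 / (cmod (1 - w))\<^sup>2) * (1 - w ^ j))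
           = of_nat j * (of_nat m - of_nat j)"
proof -
  define V where "V = {w :: complex. w ^ m = 1} - {1}"
  define c where "c w = complex_of_real (2 / (cmod (1 - w))\<^sup>2)" for w
  define S where "S j = (\<Sum>w\<in>V. c w * (1 - w ^ j))" for j
  define D where "D j = (\<Sum>w\<in>V. c w * (w ^ j - w ^ Suc j))" for j
  have fin: "finite {w :: complex. w ^ m = 1}"
    using assms by (intro finite_roots_unity) auto
  have weight: "c w * (w - 1)\<^sup>2 = - 2 * w" if "w \<in> V" for w
  proof -
    have "cmod w = 1"
      using that assms unfolding V_def by (auto dest!: power_eq_1_iff)
    then have "w * cnj w = 1"
      by (simp add: complex_norm_square[symmetric])
    then have "(w - 1)\<^sup>2 = - (of_real ((cmod (1 - w))\<^sup>2) * w)"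
      by (simp only: complex_norm_square complex_cnj_diff complex_cnj_one) algebra
    moreover have "complex_of_real ((cmod (1 - w))\<^sup>2) \<noteq> 0"
      using that by (auto simp: V_def)
    ultimately show ?thesis
      unfolding c_def of_real_divide by simp
  qed
  have sumV: "(\<Sum>w\<in>V. w ^ j) = -1" if "0 < j" "j < m" for j
    unfolding V_def using sum_power_roots_unity_eq_0[OF that] fin by (simp add: sum_diff1)
  have D_Suc: "D (Suc j) = D j - 2" if "Suc j < m" for j
  proof -
    have "D j - D (Suc j) = (\<Sum>w\<in>V. c w * (w - 1)\<^sup>2 * w ^ j)"
      unfolding D_def sum_subtractf[symmetric]
      by (intro sum.cong) (auto simp: algebra_simps power2_eq_square)
    also have "\<dots> = (\<Sum>w\<in>V. -2 * w ^ Suc j)"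
      by (intro sum.cong) (auto simp: weight)
    also have "\<dots> = 2"
      using sumV[of "Suc j"] that by (simp only: sum_distrib_left[symmetric]) simp
    finally show ?thesis
      by (simp add: algebra_simps)
  qed
  have D: "D j = D 0 - 2 * of_nat j" if "j < m" for j
    using that by (induction j) (auto simp: D_Suc algebra_simps)
  have S_Suc: "S (Suc j) = S j + D j" for j
    unfolding S_def D_def sum.distrib[symmetric]
    by (intro sum.cong) (auto simp: algebra_simps)
  have S: "S j = of_nat j * (D 0 + 1 - of_nat j)" if "j \<le> m" for j
    using that
  proof (induction j)
    case 0
    then show ?case by (simp add: S_def)
  next
    case (Suc j)
    then have "S (Suc j) = of_nat j * (D 0 + 1 - of_nat j) + (D 0 - 2 * of_nat j)"
      using D[of j] by (simp add: S_Suc)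
    then show ?case
      by (simp add: algebra_simps)
  qed
  \<comment> \<open>The slope \<open>D 0\<close> is determined by periodicity: \<open>w ^ m = 1\<close> on \<open>V\<close>.\<close>
  have "S m = 0"
    unfolding S_def by (intro sum.neutral) (auto simp: V_def)
  with S[of m] assms have "D 0 + 1 = of_nat m"
    by auto
  with S[OF assms(2)] show ?thesis
    by (simp add: S_def V_def c_def)
qed

lemma pderiv_sum: "pderiv (\<Sum>x\<in>A. f x) = (\<Sum>x\<in>A. pderiv (f x))"
  using higher_pderiv_sum[of 1 f A] by simp

lemma roots_unity_quadrature:
  fixes Q :: "complex poly"
  assumes "2 \<le> m" "degree Q \<le> m"
  shows "(\<Sum>w\<in>{w. w ^ m = 1} - {1}. of_real (2 / (cmod (1 - w))\<^sup>2) * (poly Q 1 - poly Q w))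
           = (of_nat m - 1) * poly (pderiv Q) 1 - poly (pderiv (pderiv Q)) 1"
proof -
  let ?V = "{w :: complex. w ^ m = 1} - {1}"
  let ?c = "\<lambda>w. complex_of_real (2 / (cmod (1 - w))\<^sup>2)"
  have Q: "Q = (\<Sum>j\<le>m. monom (coeff Q j) j)"
    using assms by (simp add: poly_as_sum_of_monoms')
  have poly_Q: "poly Q w = (\<Sum>j\<le>m. coeff Q j * w ^ j)" for w
    by (subst Q) (simp add: poly_sum poly_monom)
  have "(\<Sum>w\<in>?V. ?c w * (poly Q 1 - poly Q w))
          = (\<Sum>w\<in>?V. \<Sum>j\<le>m. coeff Q j * (?c w * (1 - w ^ j)))"
    by (intro sum.cong refl)
      (simp add: poly_Q sum_subtractf[symmetric] sum_distrib_left algebra_simps)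
  also have "\<dots> = (\<Sum>j\<le>m. coeff Q j * (\<Sum>w\<in>?V. ?c w * (1 - w ^ j)))"
    by (subst sum.swap) (simp add: sum_distrib_left)
  also have "\<dots> = (\<Sum>j\<le>m. coeff Q j * (of_nat j * (of_nat m - of_nat j)))"
    using assms by (intro sum.cong refl) (simp only: roots_unity_quadrature_power atMost_iff)
  also have "\<dots> = (\<Sum>j\<le>m. (of_nat m - 1) * (of_nat j * coeff Q j)
                       - of_nat (j - 1) * (of_nat j * coeff Q j))"
  proof (intro sum.cong refl)
    fix j
    show "coeff Q j * (of_nat j * (of_nat m - of_nat j))
            = (of_nat m - 1) * (of_nat j * coeff Q j) - of_nat (j - 1) * (of_nat j * coeff Q j)"
      by (cases j) (simp_all add: algebra_simps)
  qed
  also have "\<dots> = (of_nat m - 1) * poly (pderiv Q) 1 - poly (pderiv (pderiv Q)) 1"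
  proof -
    have "poly (pderiv Q) 1 = (\<Sum>j\<le>m. of_nat j * coeff Q j)"
      by (subst Q) (simp add: pderiv_sum pderiv_monom poly_sum poly_monom)
    moreover have "poly (pderiv (pderiv Q)) 1 = (\<Sum>j\<le>m. of_nat (j - 1) * (of_nat j * coeff Q j))"
      by (subst Q) (simp add: pderiv_sum pderiv_monom poly_sum poly_monom)
    ultimately show ?thesis
      by (simp add: sum_subtractf sum_distrib_left)
  qed
  finally show ?thesis .
qed

section \<open>The extremal problem on the unit disk\<close>

text \<open>
  Positivity of the quadrature weights enters here: a vanishing positive combination of the
  quantities \<open>1 - Re (Q w) \<ge> 0\<close> forces each of them to vanish.
\<close>

lemma eq_one_on_roots_unity:
  fixes Q :: "complex poly"
  assumes "2 \<le> m" "degree Q \<le> m"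
    and bound: "\<And>w. cmod w = 1 \<Longrightarrow> cmod (poly Q w) \<le> 1"
    and Q1: "poly Q 1 = 1"
    and derivs: "poly (pderiv (pderiv Q)) 1 = (of_nat m - 1) * poly (pderiv Q) 1"
    and w: "w ^ m = 1"
  shows "poly Q w = 1"
proof (cases "w = 1")
  case False
  let ?V = "{w :: complex. w ^ m = 1} - {1}"
  let ?c = "\<lambda>w. 2 / (cmod (1 - w))\<^sup>2"
  have fin: "finite ?V"
    using assms(1) by (intro finite_Diff finite_roots_unity) auto
  have norm1: "cmod v = 1" if "v ^ m = 1" for v
    using that assms(1) by (auto dest!: power_eq_1_iff)
  have Re_le: "Re (poly Q v) \<le> 1" if "v ^ m = 1" for v
    using bound[OF norm1[OF that]] complex_Re_le_cmod[of "poly Q v"] by linarith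
  have "(\<Sum>v\<in>?V. complex_of_real (?c v) * (1 - poly Q v)) = 0"
    using roots_unity_quadrature[OF assms(1,2)] Q1 derivs by simp
  then have "Re (\<Sum>v\<in>?V. complex_of_real (?c v) * (1 - poly Q v)) = 0"
    by simp
  then have "(\<Sum>v\<in>?V. ?c v * (1 - Re (poly Q v))) = 0"
    by (simp only: Re_sum Re_complex_of_real Im_complex_of_real times_complex.sel minus_complex.sel
        one_complex.sel) simp
  moreover have "?c v * (1 - Re (poly Q v)) \<ge> 0" if "v \<in> ?V" for v
    using Re_le[of v] that by (intro mult_nonneg_nonneg) auto
  ultimately have "?c w * (1 - Re (poly Q w)) = 0"
    using fin w False by (subst (asm) sum_nonneg_eq_0_iff) auto
  then have "Re (poly Q w) = 1"
    using False by simp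
  moreover have "(cmod (poly Q w))\<^sup>2 \<le> 1"
    using bound[OF norm1[OF w]] by (simp add: power_le_one)
  ultimately show ?thesis
    by (simp add: cmod_power2 complex_eq_iff)
qed (simp add: Q1)

lemma poly_eq_of_eq_one_on_roots_unity:
  fixes Q :: "complex poly"
  assumes "0 < m" "degree Q \<le> m"
    and ones: "\<And>w. w ^ m = 1 \<Longrightarrow> poly Q w = 1"
  shows "Q = 1 + smult (coeff Q m) (monom 1 m - 1)"
proof -
  define R where "R = Q - (1 + smult (coeff Q m) (monom 1 m - 1))"
  have "degree R \<le> m"
    unfolding R_def using assms(2)
    by (intro degree_diff_le degree_add_le order.trans[OF degree_smult_le])
       (auto simp: degree_monom_le)
  moreover have "coeff R m = 0"
    using assms(1) by (simp add: R_def)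
  ultimately have "R = 0 \<or> degree R < m"
    by (metis leading_coeff_0_iff le_neq_implies_less)
  moreover have "R = 0" if "degree R < m"
  proof (rule ccontr)
    assume "R \<noteq> 0"
    have "{w. w ^ m = 1} \<subseteq> {w. poly R w = 0}"
      by (auto simp: R_def ones poly_monom)
    then have "card {w :: complex. w ^ m = 1} \<le> card {w. poly R w = 0}"
      by (intro card_mono poly_roots_finite \<open>R \<noteq> 0\<close>)
    also have "\<dots> \<le> degree R"
      by (rule card_poly_roots_bound[OF \<open>R \<noteq> 0\<close>])
    finally show False
      using that assms(1) by (simp add: card_roots_unity_eq)
  qed
  ultimately show ?thesis
    by (auto simp: R_def)
qed

lemma bounded_poly_unique:
  fixes Q :: "complex poly"
  assumes "2 \<le> m" "degree Q \<le> m"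
    and "\<And>w. cmod w = 1 \<Longrightarrow> cmod (poly Q w) \<le> 1"
    and "poly Q 1 = 1"
    and Q': "poly (pderiv Q) 1 = of_nat m - 1"
    and "poly (pderiv (pderiv Q)) 1 = (of_nat m - 1)\<^sup>2"
  shows "poly Q w = (of_nat m - 1) / of_nat m * w ^ m + 1 / of_nat m"
proof -
  have "poly Q v = 1" if "v ^ m = 1" for v
    using eq_one_on_roots_unity[of m Q v] assms that by (simp add: power2_eq_square)
  then have Q: "Q = 1 + smult (coeff Q m) (monom 1 m - 1)"
    using assms by (intro poly_eq_of_eq_one_on_roots_unity) auto
  define a where "a = coeff Q m"
  have "Q = 1 + smult a (monom 1 m - 1)"
    using Q by (simp only: a_def)
  then have "poly (pderiv Q) 1 = a * of_nat m" and "poly Q w = 1 + a * (w ^ m - 1)"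
    by (simp_all add: pderiv_add pderiv_diff pderiv_smult pderiv_monom poly_monom)
  moreover from this Q' have "a = (of_nat m - 1) / of_nat m"
    using assms(1) by (simp add: field_simps)
  ultimately show ?thesis
    using assms(1) by (simp add: field_simps)
qed

section \<open>Transfer to the disk\<close>

lemma Pi_class_degree_le:
  assumes "P \<in> Pi_class m n"
  shows "degree P \<le> m"
proof -
  obtain \<alpha> where "P = (\<Sum>k\<le>m. monom (\<alpha> k / fact k) k)"
    using assms by (auto simp: Pi_class_def)
  then show ?thesis
    by (auto intro!: degree_sum_le order.trans[OF degree_monom_le])
qed

lemma Pi_class_coeff:
  assumes "P \<in> Pi_class m n" "n \<le> m" "k \<le> n"
  shows "coeff P k = 1 / fact k"
  using assms by (auto simp: Pi_class_def coeff_sum)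

theorem proposition4:
  fixes m :: nat and P :: "complex poly"
  assumes "m \<ge> 2"
    and "P \<in> Pi_class m 2"
  shows "disk (real m - 1) \<subseteq> stability_region P \<longleftrightarrow>
    (\<forall>z. poly P z =
      (of_nat m - 1) / of_nat m * (1 + z / (of_nat m - 1)) ^ m + 1 / of_nat m)"
proof -
  define r :: complex where "r = of_nat m - 1"
  have r_real: "r = of_real (real m - 1)"
    by (simp add: r_def)
  have norm_r: "cmod r = real m - 1"
    unfolding r_real norm_of_real using assms(1) by simp
  then have r0: "r \<noteq> 0"
    using assms(1) by auto
  have disk_iff: "z \<in> disk (real m - 1) \<longleftrightarrow> cmod (1 + z / r) \<le> 1" for z
  proof -
    have "1 + z / r = (z + r) / r"
      using r0 by (simp add: field_simps)
    then have "cmod (1 + z / r) = cmod (z + r) / (real m - 1)"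
      by (simp only: norm_divide norm_r)
    then show ?thesis
      using assms(1) by (simp add: disk_def r_real)
  qed
  show ?thesis
  proof
    assume sub: "disk (real m - 1) \<subseteq> stability_region P"
    define Q where "Q = pcompose P [:- r, r:]"
    have poly_Q: "poly Q w = poly P (r * (w - 1))" for w
      by (simp add: Q_def poly_pcompose algebra_simps)
    have coeffs: "coeff P 0 = 1" "coeff P 1 = 1" "2 * coeff P (Suc (Suc 0)) = 1"
      using Pi_class_coeff[OF assms(2,1)] by simp_all
    have "degree Q \<le> m"
      using Pi_class_degree_le[OF assms(2)] r0 by (simp add: Q_def degree_pcompose)
    moreover have "cmod (poly Q w) \<le> 1" if "cmod w = 1" for w
    proof -
      have "r * (w - 1) \<in> disk (real m - 1)"
        using that r0 by (simp add: disk_iff)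
      then show ?thesis
        using sub by (auto simp: stability_region_def poly_Q)
    qed
    moreover have "poly Q 1 = 1"
      using coeffs by (simp add: poly_Q poly_0_coeff_0)
    moreover have "poly (pderiv Q) 1 = r"
      using coeffs
      by (simp add: Q_def pderiv_pcompose poly_pcompose pderiv_pCons poly_0_coeff_0 coeff_pderiv)
    moreover have "poly (pderiv (pderiv Q)) 1 = r\<^sup>2"
      using coeffs
      by (simp add: Q_def pderiv_pcompose poly_pcompose pderiv_pCons pderiv_smult poly_0_coeff_0
          coeff_pderiv power2_eq_square)
    ultimately have "poly Q w = r / of_nat m * w ^ m + 1 / of_nat m" for w
      using bounded_poly_unique[OF assms(1), of Q w] by (simp add: r_def)
    from this[of "1 + z / r" for z]
    have "poly P z = r / of_nat m * (1 + z / r) ^ m + 1 / of_nat m" for z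
      using r0 by (simp add: poly_Q)
    then show "\<forall>z. poly P z =
        (of_nat m - 1) / of_nat m * (1 + z / (of_nat m - 1)) ^ m + 1 / of_nat m"
      by (simp add: r_def)
  next
    assume P: "\<forall>z. poly P z =
        (of_nat m - 1) / of_nat m * (1 + z / (of_nat m - 1)) ^ m + 1 / of_nat m"
    show "disk (real m - 1) \<subseteq> stability_region P"
    proof
      fix z assume z: "z \<in> disk (real m - 1)"
      have "cmod (poly P z) = cmod (r / of_nat m * (1 + z / r) ^ m + 1 / of_nat m)"
        using P by (simp add: r_def)
      also have "\<dots> \<le> (real m - 1) / real m * cmod (1 + z / r) ^ m + 1 / real m"
        by (rule norm_triangle_le) (simp add: norm_mult norm_divide norm_power norm_r)
      also have "\<dots> \<le> (real m - 1) / real m * 1 + 1 / real m"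
        using z assms(1)
        by (intro add_right_mono mult_left_mono power_le_one) (auto simp: disk_iff)
      also have "\<dots> = 1"
        using assms(1) by (simp add: field_simps)
      finally show "z \<in> stability_region P"
        by (simp add: stability_region_def)
    qed
  qed
qed

end
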